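(* Let $S\subset\mathbb{Z}^d$ be a uniquely presented pointed affine semigroup generated by $\mathcal{A}=\{a_1,\ldots,a_n\}$. Let $w\in\mathbb{N}^n$ be such that some minimal generating set of $I_{\mathcal{A}}$ is also a Gröbner basis with respect to some refined order $>_w$. Then all Betti elements of $S_w=\mathbb{N}\mathcal{A}_w$ are Betti-minimal. In particular, $I_{\mathcal{A}_w}$ is also uniquely presented.
   Context: $\mathbb{N}$ contains $0$ and $\mathbb{K}$ is a field. An affine semigroup is a finitely generated submonoid $S$ of $\mathbb{Z}^d$ such that the group generated by $S$ is $\mathbb{Z}^d$; it is pointed if $S\cap(-S)=\{0\}$. For $\mathcal{A}=\{a_1,\ldots,a_n\}$ and $w=(w_1,\ldots,w_n)\in\mathbb{N}^n$, $\mathcal{A}_w:=\{(a_1,w_1),\ldots,(a_n,w_n),(0,\ldots,0,1)\}\subset\mathbb{Z}^{d+1}$, and $\mathbb{N}\mathcal{A}_w$ is the submonoid it generates. Toric ideals and Betti elements: let $\pi_{\mathcal{A}}:\mathbb{N}^n\to\mathbb{Z}^d$, $u\mapsto u_1a_1+\cdots+u_na_n$. The toric ideal is $I_{\mathcal{A}}=\langle x^u-x^v\mid\pi_{\mathcal{A}}(u)=\pi_{\mathcal{A}}(v)\rangle\subset\mathbb{K}[x_1,\ldots,x_n]$. Let $\sim_{\mathcal{A}}$ be the kernel congruence of $\pi_{\mathcal{A}}$. A minimal presentation of $S=\mathbb{N}\mathcal{A}$ is a minimal system of generators $\rho\subset\mathbb{N}^n\times\mathbb{N}^n$ of $\sim_{\mathcal{A}}$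 (equivalently, a minimal set of binomial generators $x^\alpha-x^\beta$ of $I_{\mathcal{A}}$). $\operatorname{Betti}(S):=\{\pi_{\mathcal{A}}(\alpha)\mid(\alpha,\beta)\in\rho\}$ for any minimal presentation $\rho$ (independent of $\rho$). $I_{\mathcal{A}_w}\subset\mathbb{K}[x_1,\ldots,x_n,t]$ and $\operatorname{Betti}(S_w)$ are defined in the same way from $\mathcal{A}_w$. $S$ (or $I_{\mathcal{A}}$) is uniquely presented if it has a unique minimal presentation, equivalently if $I_{\mathcal{A}}$ has a unique minimal generating set of binomials, up to scalar multiplication; the same terminology applies to $\mathcal{A}_w$. Order the pointed semigroup $S$ by $\alpha>_S\beta$ if $\alpha-\beta\in S$; an element of $\operatorname{Betti}(S)$ is Betti-minimal if it is minimal in $\operatorname{Betti}(S)$ with respect to this order (similarly for $S_w$, with its own order). A refined order $>_w$ is a monomial order refining $w$: monomials $x^u,x^v$ are first compared by the weights $w\cdot u$, $w\cdot v$, and ties are broken by some monomial order. *)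

theory Defs
  imports Complex_Main "HOL-Library.Poly_Mapping"
begin

text \<open>
  A vector of \<open>\<int>\<^sup>d\<close> is a finitely supported function on the coordinates \<open>0, \<dots>, d - 1\<close>, and
  \<open>\<int>\<^sup>d\<close> is thereby contained in \<open>\<int>\<^bsup>d+1\<^esup>\<close>.  Exponent vectors of \<open>n\<close> variables are treated in
  the same way; the variables are numbered \<open>0, \<dots>, n - 1\<close>.  Scalar multiplication and unit
  vectors of \<open>\<int>\<^sup>d\<close> are the library's \<^const>\<open>frag_cmul\<close> and \<^const>\<open>frag_of\<close>.
\<close>

type_synonym intvec = "nat \<Rightarrow>\<^sub>0 int"
type_synonym expvec = "nat \<Rightarrow>\<^sub>0 nat"
type_synonym 'k mpol = "expvec \<Rightarrow>\<^sub>0 'k"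

definition int_vecs :: "nat \<Rightarrow> intvec set" where
  "int_vecs d = {v. Poly_Mapping.keys v \<subseteq> {..<d}}"

definition exp_vecs :: "nat \<Rightarrow> expvec set" where
  "exp_vecs n = {u. Poly_Mapping.keys u \<subseteq> {..<n}}"

section \<open>Affine semigroups\<close>

definition is_submonoid :: "intvec set \<Rightarrow> bool" where
  "is_submonoid M \<longleftrightarrow> 0 \<in> M \<and> (\<forall>x\<in>M. \<forall>y\<in>M. x + y \<in> M)"

definition is_subgroup :: "intvec set \<Rightarrow> bool" where
  "is_subgroup H \<longleftrightarrow> 0 \<in> H \<and> (\<forall>x\<in>H. \<forall>y\<in>H. x + y \<in> H) \<and> (\<forall>x\<in>H. - x \<in> H)"

definition affine_semigroup :: "nat \<Rightarrow> intvec set \<Rightarrow> bool" where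
  "affine_semigroup d S \<longleftrightarrow>
     S \<subseteq> int_vecs d \<and> (\<exists>A. finite A \<and> S = is_submonoid hull A) \<and> is_subgroup hull S = int_vecs d"

definition pointed :: "intvec set \<Rightarrow> bool" where
  "pointed S \<longleftrightarrow> S \<inter> uminus ` S = {0}"

text \<open>The semigroup \<open>\<nat>{a\<^sub>0, \<dots>, a\<^bsub>n-1\<^esub>}\<close>.\<close>

definition semigroup_of :: "nat \<Rightarrow> (nat \<Rightarrow> intvec) \<Rightarrow> intvec set" where
  "semigroup_of n a = is_submonoid hull (a ` {..<n})"

text \<open>
  The \<open>n + 1\<close> generators of \<open>\<nat>\<A>\<^sub>w\<close> in \<open>\<int>\<^bsup>d+1\<^esup>\<close>: the new coordinate has number \<open>d\<close>, and the new
  variable \<open>t\<close> has number \<open>n\<close>.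
\<close>

definition weighted_gens :: "nat \<Rightarrow> nat \<Rightarrow> (nat \<Rightarrow> intvec) \<Rightarrow> (nat \<Rightarrow> nat) \<Rightarrow> nat \<Rightarrow> intvec" where
  "weighted_gens d n a w i =
     (if i < n then a i + frag_cmul (int (w i)) (frag_of d) else frag_of d)"

section \<open>Presentations and Betti elements\<close>

definition factor_map :: "nat \<Rightarrow> (nat \<Rightarrow> intvec) \<Rightarrow> expvec \<Rightarrow> intvec" where
  "factor_map n a u = (\<Sum>i<n. frag_cmul (int (Poly_Mapping.lookup u i)) (a i))"

definition kernel_congruence :: "nat \<Rightarrow> (nat \<Rightarrow> intvec) \<Rightarrow> expvec rel" where
  "kernel_congruence n a =
     {(u, v). u \<in> exp_vecs n \<and> v \<in> exp_vecs n \<and> factor_map n a u = factor_map n a v}"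

definition is_congruence :: "nat \<Rightarrow> expvec rel \<Rightarrow> bool" where
  "is_congruence n C \<longleftrightarrow>
     equiv (exp_vecs n) C \<and> (\<forall>u v c. (u, v) \<in> C \<and> c \<in> exp_vecs n \<longrightarrow> (u + c, v + c) \<in> C)"

definition is_presentation :: "nat \<Rightarrow> (nat \<Rightarrow> intvec) \<Rightarrow> expvec rel \<Rightarrow> bool" where
  "is_presentation n a \<rho> \<longleftrightarrow>
     \<rho> \<subseteq> exp_vecs n \<times> exp_vecs n \<and> is_congruence n hull \<rho> = kernel_congruence n a"

definition minimal_presentation :: "nat \<Rightarrow> (nat \<Rightarrow> intvec) \<Rightarrow> expvec rel \<Rightarrow> bool" where
  "minimal_presentation n a \<rho> \<longleftrightarrow>
     is_presentation n a \<rho> \<and> (\<forall>\<rho>'. \<rho>' \<subset> \<rho> \<longrightarrow> \<not> is_presentation n a \<rho>')"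

text \<open>
  Uniqueness is up to exchanging \<open>(\<alpha>, \<beta>)\<close> and \<open>(\<beta>, \<alpha>)\<close>, which corresponds to the sign of the
  binomial \<open>x\<^sup>\<alpha> - x\<^sup>\<beta>\<close>; read literally, only the empty presentation would be unique.
\<close>

definition uniquely_presented :: "nat \<Rightarrow> (nat \<Rightarrow> intvec) \<Rightarrow> bool" where
  "uniquely_presented n a \<longleftrightarrow>
     (\<exists>\<rho>. minimal_presentation n a \<rho> \<and>
        (\<forall>\<rho>'. minimal_presentation n a \<rho>' \<longrightarrow> \<rho>' \<union> \<rho>'\<inverse> = \<rho> \<union> \<rho>\<inverse>))"

text \<open>
  All minimal presentations of a pointed affine semigroup yield the same Betti elements; the
  union over all of them avoids a choice.
\<close>

definition Betti :: "nat \<Rightarrow> (nat \<Rightarrow> intvec) \<Rightarrow> intvec set" where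
  "Betti n a = {factor_map n a \<alpha> |\<alpha> \<beta> \<rho>. minimal_presentation n a \<rho> \<and> (\<alpha>, \<beta>) \<in> \<rho>}"

definition semigroup_greater :: "intvec set \<Rightarrow> intvec \<Rightarrow> intvec \<Rightarrow> bool" where
  "semigroup_greater S \<alpha> \<beta> \<longleftrightarrow> \<alpha> \<noteq> \<beta> \<and> \<alpha> - \<beta> \<in> S"

definition Betti_minimal :: "nat \<Rightarrow> (nat \<Rightarrow> intvec) \<Rightarrow> intvec \<Rightarrow> bool" where
  "Betti_minimal n a b \<longleftrightarrow>
     b \<in> Betti n a \<and> (\<forall>c\<in>Betti n a. \<not> semigroup_greater (semigroup_of n a) b c)"

section \<open>Toric ideals and Groebner bases\<close>

definition polys :: "nat \<Rightarrow> 'k::field mpol set" where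
  "polys n = {p. Poly_Mapping.keys p \<subseteq> exp_vecs n}"

text \<open>The ideal of \<open>\<K>[x\<^sub>0, \<dots>, x\<^bsub>n-1\<^esub>]\<close> generated by \<open>F\<close>.\<close>

definition ideal_gen :: "nat \<Rightarrow> 'k::field mpol set \<Rightarrow> 'k mpol set" where
  "ideal_gen n F = {\<Sum>f\<in>B. q f * f |B q. finite B \<and> B \<subseteq> F \<and> (\<forall>f\<in>B. q f \<in> polys n)}"

definition toric_ideal :: "nat \<Rightarrow> (nat \<Rightarrow> intvec) \<Rightarrow> 'k::field mpol set" where
  "toric_ideal n a = ideal_gen n
     {Poly_Mapping.single u 1 - Poly_Mapping.single v 1 |u v.
        u \<in> exp_vecs n \<and> v \<in> exp_vecs n \<and> factor_map n a u = factor_map n a v}"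

text \<open>Scalar multiples of \<open>x\<^sup>u - x\<^sup>v\<close>.\<close>

definition binomials :: "nat \<Rightarrow> 'k::field mpol set" where
  "binomials n = {Poly_Mapping.single u c - Poly_Mapping.single v c |u v c.
     u \<in> exp_vecs n \<and> v \<in> exp_vecs n \<and> u \<noteq> v \<and> c \<noteq> 0}"

text \<open>
  As usual for toric ideals, minimal generating sets consist of binomials.  Arbitrary
  polynomials are not admitted: an ideal can have inhomogeneous generating sets that are
  irredundant without being of least size.
\<close>

definition minimal_generating_set :: "nat \<Rightarrow> 'k::field mpol set \<Rightarrow> 'k mpol set \<Rightarrow> bool" where
  "minimal_generating_set n I G \<longleftrightarrow>
     G \<subseteq> binomials n \<and> ideal_gen n G = I \<and> (\<forall>G'. G' \<subset> G \<longrightarrow> ideal_gen n G' \<noteq> I)"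

text \<open>\<open>(u, v) \<in> r\<close> means \<open>x\<^sup>u \<le> x\<^sup>v\<close>.\<close>

definition monomial_order :: "nat \<Rightarrow> expvec rel \<Rightarrow> bool" where
  "monomial_order n r \<longleftrightarrow>
     well_order_on (exp_vecs n) r \<and>
     (\<forall>u v c. (u, v) \<in> r \<and> c \<in> exp_vecs n \<longrightarrow> (u + c, v + c) \<in> r)"

definition weight :: "nat \<Rightarrow> (nat \<Rightarrow> nat) \<Rightarrow> expvec \<Rightarrow> nat" where
  "weight n w u = (\<Sum>i<n. w i * Poly_Mapping.lookup u i)"

definition refined_order :: "nat \<Rightarrow> (nat \<Rightarrow> nat) \<Rightarrow> expvec rel \<Rightarrow> expvec rel" where
  "refined_order n w r =
     {(u, v). u \<in> exp_vecs n \<and> v \<in> exp_vecs n \<and>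
        (weight n w u < weight n w v \<or> weight n w u = weight n w v \<and> (u, v) \<in> r)}"

definition lead_exp :: "expvec rel \<Rightarrow> 'k::field mpol \<Rightarrow> expvec" where
  "lead_exp r p = (THE u. u \<in> Poly_Mapping.keys p \<and> (\<forall>v\<in>Poly_Mapping.keys p. (v, u) \<in> r))"

definition initial_ideal :: "nat \<Rightarrow> expvec rel \<Rightarrow> 'k::field mpol set \<Rightarrow> 'k mpol set" where
  "initial_ideal n r F = ideal_gen n {Poly_Mapping.single (lead_exp r f) 1 |f. f \<in> F \<and> f \<noteq> 0}"

definition groebner_basis :: "nat \<Rightarrow> expvec rel \<Rightarrow> 'k::field mpol set \<Rightarrow> 'k mpol set \<Rightarrow> bool" where
  "groebner_basis n r I G \<longleftrightarrow>
     finite G \<and> G \<subseteq> I \<and> initial_ideal n r G = initial_ideal n r I"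

end

theory Submission
  imports Defs
begin

text \<open>
  Unique presentability forces every pair \<open>(u, v)\<close> of the minimal presentation of \<open>S\<close> to be the
  whole fiber of its Betti element, with \<open>u\<close> and \<open>v\<close> disjoint.  Because \<open>G\<close> is a Groebner basis for
  an order refining \<open>w\<close>, homogenizing its binomials to \<open>x\<^sup>u - x\<^sup>v t\<^bsup>w\<cdot>u - w\<cdot>v\<^esup>\<close> gives a
  presentation of \<open>S\<^sub>w\<close>.  The fiber of \<open>S\<^sub>w\<close> through \<open>u\<close> injects into that of \<open>S\<close>, hence consists
  again of two disjoint elements.  A semigroup all of whose relations have this form is uniquely
  presented, and a Betti element strictly above another one would have two factorizations
  with a common summand.
\<close>

section \<open>Congruences and presentations\<close>

lemma exp_vecs_zero [simp]: "0 \<in> exp_vecs n"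
  by (simp add: exp_vecs_def)

lemma keys_add_nat: "Poly_Mapping.keys (u + v) = Poly_Mapping.keys u \<union> Poly_Mapping.keys v"
  for u v :: expvec
  by (auto simp: in_keys_iff lookup_add)

lemma exp_vecs_add [simp]: "u + v \<in> exp_vecs n \<longleftrightarrow> u \<in> exp_vecs n \<and> v \<in> exp_vecs n"
  by (auto simp: exp_vecs_def keys_add_nat)

lemma factor_map_add: "factor_map n a (u + v) = factor_map n a u + factor_map n a v"
  by (simp add: factor_map_def lookup_add frag_cmul_distrib sum.distrib)

lemma weight_add: "weight n w (u + v) = weight n w u + weight n w v"
  by (simp add: weight_def lookup_add algebra_simps sum.distrib)

lemma is_congruenceI:
  assumes "C \<subseteq> exp_vecs n \<times> exp_vecs n"
    and "\<And>u. u \<in> exp_vecs n \<Longrightarrow> (u, u) \<in> C"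
    and "\<And>u v. (u, v) \<in> C \<Longrightarrow> (v, u) \<in> C"
    and "\<And>u v x. (u, v) \<in> C \<Longrightarrow> (v, x) \<in> C \<Longrightarrow> (u, x) \<in> C"
    and "\<And>u v c. (u, v) \<in> C \<Longrightarrow> c \<in> exp_vecs n \<Longrightarrow> (u + c, v + c) \<in> C"
  shows "is_congruence n C"
  unfolding is_congruence_def equiv_def refl_on_def sym_def trans_def using assms by blast

lemma is_congruenceD:
  assumes "is_congruence n C"
  shows "C \<subseteq> exp_vecs n \<times> exp_vecs n"
    and "u \<in> exp_vecs n \<Longrightarrow> (u, u) \<in> C"
    and "(u, v) \<in> C \<Longrightarrow> (v, u) \<in> C"
    and "(u, v) \<in> C \<Longrightarrow> (v, x) \<in> C \<Longrightarrow> (u, x) \<in> C"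
    and "(u, v) \<in> C \<Longrightarrow> c \<in> exp_vecs n \<Longrightarrow> (u + c, v + c) \<in> C"
  using assms unfolding is_congruence_def equiv_def refl_on_def sym_def trans_def by blast+

text \<open>The full relation on \<open>exp_vecs n\<close> is a congruence containing
  \<open>\<rho>\<close>, so the hull is an intersection over a nonempty family. For a relation
  outside \<open>exp_vecs n\<close> the family is empty and the hull is the universal
  relation.\<close>

lemma is_congruence_hull:
  assumes "\<rho> \<subseteq> exp_vecs n \<times> exp_vecs n"
  shows "is_congruence n (is_congruence n hull \<rho>)"
proof (rule is_congruenceI)
  have "is_congruence n (exp_vecs n \<times> exp_vecs n)"
    by (rule is_congruenceI) auto
  then show "is_congruence n hull \<rho> \<subseteq> exp_vecs n \<times> exp_vecs n"
    using assms by (rule hull_minimal[rotated])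
qed (auto simp: hull_def intro: is_congruenceD(2-5))

lemma is_congruence_kernel: "is_congruence n (kernel_congruence n a)"
  by (rule is_congruenceI) (auto simp: kernel_congruence_def factor_map_add)

lemma kernel_congruence_subset: "kernel_congruence n a \<subseteq> exp_vecs n \<times> exp_vecs n"
  by (auto simp: kernel_congruence_def)

lemma is_presentation_subset_kernel:
  assumes "is_presentation n a \<rho>"
  shows "\<rho> \<subseteq> kernel_congruence n a"
  using assms unfolding is_presentation_def by (metis hull_subset)

lemma is_presentationI:
  assumes "\<rho> \<subseteq> kernel_congruence n a"
    and "\<And>x y. (x, y) \<in> kernel_congruence n a \<Longrightarrow> (x, y) \<in> is_congruence n hull \<rho>"
  shows "is_presentation n a \<rho>"
  unfolding is_presentation_def
  using assms kernel_congruence_subset hull_minimal[where S = "is_congruence n", OF assms(1) is_congruence_kernel[of n a]] by blast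

text \<open>A congruence that contains \<open>\<rho>\<close> contains all that \<open>\<rho>\<close>
  generates, here the whole kernel. Every exchange of relations below goes through this.\<close>

lemma is_presentation_transfer:
  assumes \<rho>: "is_presentation n a \<rho>" and sub: "\<rho>' \<subseteq> kernel_congruence n a"
    and "\<rho> \<subseteq> is_congruence n hull \<rho>'"
  shows "is_presentation n a \<rho>'"
proof (rule is_presentationI[OF sub])
  have "is_congruence n (is_congruence n hull \<rho>')"
    using sub kernel_congruence_subset by (blast intro: is_congruence_hull)
  then have "kernel_congruence n a \<subseteq> is_congruence n hull \<rho>'"
    using \<rho> assms(3) unfolding is_presentation_def by (metis hull_minimal)
  then show "(x, y) \<in> is_congruence n hull \<rho>'" if "(x, y) \<in> kernel_congruence n a" for x y
    using that by blast
qed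

lemma finite_presentation_minimal:
  assumes "is_presentation n a \<rho>" "finite \<rho>"
  obtains \<rho>' where "\<rho>' \<subseteq> \<rho>" "minimal_presentation n a \<rho>'"
proof -
  let ?P = "{\<rho>' \<in> Pow \<rho>. is_presentation n a \<rho>'}"
  obtain m where m: "m \<in> ?P" "m \<le> \<rho>" "\<forall>b\<in>?P. b \<le> m \<longrightarrow> m = b"
    using finite_has_minimal2[of ?P \<rho>] assms by auto
  have "minimal_presentation n a m"
    unfolding minimal_presentation_def
  proof (intro conjI allI impI notI)
    fix \<rho>' assume "\<rho>' \<subset> m" "is_presentation n a \<rho>'"
    then show False using m by blast
  qed (use m in blast)
  with m(2) show thesis by (rule that)
qed

section \<open>Unique minimal presentations\<close>

lemma minimal_presentation_irredundant:
  assumes \<rho>: "minimal_presentation n a \<rho>" and p: "p \<in> \<rho>"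
  shows "p \<notin> is_congruence n hull (\<rho> - {p})"
proof
  assume *: "p \<in> is_congruence n hull (\<rho> - {p})"
  have pres: "is_presentation n a \<rho>"
    using \<rho> by (simp add: minimal_presentation_def)
  have "\<rho> \<subseteq> is_congruence n hull (\<rho> - {p})"
    using * by (auto intro: hull_inc)
  then have "is_presentation n a (\<rho> - {p})"
    using is_presentation_transfer[OF pres] is_presentation_subset_kernel[OF pres] by blast
  moreover have "\<rho> - {p} \<subset> \<rho>" using p by blast
  ultimately show False using \<rho> unfolding minimal_presentation_def by blast
qed

text \<open>Trading \<open>(\<alpha>, \<beta>)\<close> for \<open>X\<close> again gives a
  presentation, which by finiteness contains a minimal one. Uniqueness puts the pair, up to
  orientation, back into that one, and only \<open>X\<close> can have supplied it.\<close>

lemma unique_presentation_exchange: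
  assumes uniq: "uniquely_presented n a" and min: "minimal_presentation n a \<rho>" "finite \<rho>"
    and mem: "(\<alpha>, \<beta>) \<in> \<rho>"
    and X: "finite X" "X \<subseteq> kernel_congruence n a"
    and gen: "(\<alpha>, \<beta>) \<in> is_congruence n hull (\<rho> - {(\<alpha>, \<beta>)} \<union> X)"
  shows "(\<alpha>, \<beta>) \<in> X \<union> X\<inverse>"
proof (rule ccontr)
  assume no: "(\<alpha>, \<beta>) \<notin> X \<union> X\<inverse>"
  let ?\<rho> = "\<rho> - {(\<alpha>, \<beta>)} \<union> X"
  have pres: "is_presentation n a \<rho>"
    using min by (simp add: minimal_presentation_def)
  note sub = is_presentation_subset_kernel[OF pres]
  have "\<rho> \<subseteq> is_congruence n hull ?\<rho>"
    using gen hull_subset[of ?\<rho> "is_congruence n"] by blast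
  then have "is_presentation n a ?\<rho>"
    using is_presentation_transfer[OF pres, of ?\<rho>] X sub by blast
  moreover have "finite ?\<rho>" using min(2) X(1) by simp
  ultimately obtain \<rho>' where \<rho>': "\<rho>' \<subseteq> ?\<rho>" "minimal_presentation n a \<rho>'"
    by (rule finite_presentation_minimal)
  then have "\<rho>' \<union> \<rho>'\<inverse> = \<rho> \<union> \<rho>\<inverse>"
    using uniq min(1) unfolding uniquely_presented_def by metis
  then have "(\<alpha>, \<beta>) \<in> \<rho>' \<union> \<rho>'\<inverse>" using mem by blast
  \<comment> \<open>The pair itself was removed and \<open>X\<close> contains neither orientation,
    so only the reversed pair is left. It would make \<open>(\<alpha>, \<beta>)\<close> redundant in
    \<open>\<rho>\<close> by symmetry.\<close>
  then have swap: "(\<beta>, \<alpha>) \<in> \<rho> - {(\<alpha>, \<beta>)}"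
    using no \<rho>'(1) by blast
  have "\<rho> - {(\<alpha>, \<beta>)} \<subseteq> exp_vecs n \<times> exp_vecs n"
    using sub kernel_congruence_subset by blast
  then have "(\<alpha>, \<beta>) \<in> is_congruence n hull (\<rho> - {(\<alpha>, \<beta>)})"
    using is_congruenceD(3)[OF is_congruence_hull] hull_inc[OF swap] by blast
  then show False
    using minimal_presentation_irredundant[OF min(1) mem] by blast
qed

lemma unique_presentation_fiber:
  assumes uniq: "uniquely_presented n a" and min: "minimal_presentation n a \<rho>" "finite \<rho>"
    and mem: "(\<alpha>, \<beta>) \<in> \<rho>"
    and \<gamma>: "\<gamma> \<in> exp_vecs n" "factor_map n a \<gamma> = factor_map n a \<alpha>"
  shows "\<gamma> = \<alpha> \<or> \<gamma> = \<beta>"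
proof -
  \<comment> \<open>A third factorization \<open>\<gamma>\<close> would allow a detour replacing \<open>(\<alpha>, \<beta>)\<close>.\<close>
  let ?X = "{(\<alpha>, \<gamma>), (\<gamma>, \<beta>)}"
  have ker: "\<rho> \<subseteq> kernel_congruence n a"
    using min by (simp add: minimal_presentation_def is_presentation_subset_kernel)
  then have X: "?X \<subseteq> kernel_congruence n a"
    using mem \<gamma> by (auto simp: kernel_congruence_def)
  let ?\<rho> = "\<rho> - {(\<alpha>, \<beta>)} \<union> ?X"
  have "?\<rho> \<subseteq> exp_vecs n \<times> exp_vecs n"
    using X ker kernel_congruence_subset by blast
  then have "(\<alpha>, \<beta>) \<in> is_congruence n hull ?\<rho>"
    by (intro is_congruenceD(4)[OF is_congruence_hull, of _ _ \<alpha> \<gamma> \<beta>] hull_inc) auto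
  then have "(\<alpha>, \<beta>) \<in> ?X \<union> ?X\<inverse>"
    using unique_presentation_exchange[OF uniq min mem _ X] by blast
  then show ?thesis by auto
qed

text \<open>Cancelling \<open>c\<close> stays inside the kernel and translating by \<open>c\<close>
  recovers the pair, so the cancelled pair is a legitimate replacement. By exchange the two agree up
  to orientation.\<close>

lemma unique_presentation_disjoint:
  assumes uniq: "uniquely_presented n a" and min: "minimal_presentation n a \<rho>" "finite \<rho>"
    and mem: "(\<alpha> + c, \<beta> + c) \<in> \<rho>"
  shows "c = 0"
proof -
  let ?X = "{(\<alpha>, \<beta>)}"
  have ker: "\<rho> \<subseteq> kernel_congruence n a"
    using min by (simp add: minimal_presentation_def is_presentation_subset_kernel)
  then have X: "?X \<subseteq> kernel_congruence n a" and c: "c \<in> exp_vecs n"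
    using mem by (auto simp: kernel_congruence_def factor_map_add)
  let ?\<rho> = "\<rho> - {(\<alpha> + c, \<beta> + c)} \<union> ?X"
  have "?\<rho> \<subseteq> exp_vecs n \<times> exp_vecs n"
    using X ker kernel_congruence_subset by blast
  then have "(\<alpha> + c, \<beta> + c) \<in> is_congruence n hull ?\<rho>"
    using c by (intro is_congruenceD(5)[OF is_congruence_hull] hull_inc) auto
  then have "(\<alpha> + c, \<beta> + c) \<in> ?X \<union> ?X\<inverse>"
    using unique_presentation_exchange[OF uniq min mem _ X] by blast
  \<comment> \<open>With equal orientation \<open>c\<close> cancels; with reversed orientation
    substitution yields \<open>c + c = 0\<close>, solved only by zero in natural exponents.\<close>
  then have "\<alpha> + c = \<alpha> \<or> \<alpha> + c = \<beta> \<and> \<beta> + c = \<alpha>"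
    by blast
  then have "\<alpha> + c = \<alpha> \<or> \<alpha> + (c + c) = \<alpha>"
    by (metis add.assoc)
  then have "c = 0 \<or> c + c = 0"
    by (metis add_cancel_right_right)
  then show "c = 0"
    by (metis keys_add_nat keys_eq_empty sup.idem)
qed

section \<open>Presentations in which every relation is a whole two-element fiber\<close>

text \<open>The last condition says that \<open>x\<^sup>\<alpha>\<close> and \<open>x\<^sup>\<beta>\<close> have no variable in common.\<close>

definition uniform_presentation :: "nat \<Rightarrow> (nat \<Rightarrow> intvec) \<Rightarrow> expvec rel \<Rightarrow> bool" where
  "uniform_presentation n a \<rho> \<longleftrightarrow>
     is_presentation n a \<rho> \<and> (\<forall>\<alpha> \<beta>. (\<alpha>, \<beta>) \<in> \<rho> \<longrightarrow> (\<beta>, \<alpha>) \<notin> \<rho> \<and>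
       (\<forall>\<gamma> \<in> exp_vecs n. factor_map n a \<gamma> = factor_map n a \<alpha> \<longrightarrow> \<gamma> = \<alpha> \<or> \<gamma> = \<beta>) \<and>
       (\<forall>\<alpha>' \<beta>' c. \<alpha> = \<alpha>' + c \<longrightarrow> \<beta> = \<beta>' + c \<longrightarrow> c = 0))"

lemma uniform_presentationD:
  assumes "uniform_presentation n a \<rho>"
  shows "is_presentation n a \<rho>"
    and "(\<alpha>, \<beta>) \<in> \<rho> \<Longrightarrow> (\<beta>, \<alpha>) \<notin> \<rho>"
    and "(\<alpha>, \<beta>) \<in> \<rho> \<Longrightarrow> \<gamma> \<in> exp_vecs n \<Longrightarrow> factor_map n a \<gamma> = factor_map n a \<alpha> \<Longrightarrow>
      \<gamma> = \<alpha> \<or> \<gamma> = \<beta>"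
    and "(\<alpha>' + c, \<beta>' + c) \<in> \<rho> \<Longrightarrow> c = 0"
proof -
  assume mem: "(\<alpha>' + c, \<beta>' + c) \<in> \<rho>"
  with assms show "c = 0" unfolding uniform_presentation_def by metis
qed (use assms in \<open>simp_all add: uniform_presentation_def\<close>)

text \<open>These relations are indispensable: no chain through a third factorization and no
  translate of a smaller relation can produce them.\<close>

lemma uniform_presentation_subset:
  assumes \<rho>: "uniform_presentation n a \<rho>" and \<rho>': "is_presentation n a \<rho>'"
  shows "\<rho> \<subseteq> \<rho>' \<union> \<rho>'\<inverse>"
proof (clarify, rule ccontr)
  fix \<alpha> \<beta> assume mem: "(\<alpha>, \<beta>) \<in> \<rho>" and no: "(\<alpha>, \<beta>) \<notin> \<rho>'" "(\<beta>, \<alpha>) \<notin> \<rho>'"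
  note U = uniform_presentationD[OF \<rho>]
  let ?K = "kernel_congruence n a"
  note K = is_congruenceD[OF is_congruence_kernel[of n a]]
  \<comment> \<open>A trivial pair would be its own reversal, which the asymmetry clause forbids.
    Hence \<open>?D\<close> below is still reflexive.\<close>
  have ne: "\<alpha> \<noteq> \<beta>" using U(2) mem by blast
  have ker: "(\<alpha>, \<beta>) \<in> ?K"
    using is_presentation_subset_kernel[OF U(1)] mem by blast
  \<comment> \<open>Were the pair missing from \<open>\<rho>'\<close>, the congruence \<open>?D\<close> would contain \<open>\<rho>'\<close>.\<close>
  let ?D = "?K - {(\<alpha>, \<beta>), (\<beta>, \<alpha>)}"
  have fib: "\<gamma> = \<alpha> \<or> \<gamma> = \<beta>" if "(\<alpha>, \<gamma>) \<in> ?K" for \<gamma>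
    using U(3)[OF mem] that by (auto simp: kernel_congruence_def)
  have fib': "\<gamma> = \<alpha> \<or> \<gamma> = \<beta>" if "(\<beta>, \<gamma>) \<in> ?K" for \<gamma>
    using fib that ker K(4) by blast
  \<comment> \<open>A chain from \<open>\<alpha>\<close> to \<open>\<beta>\<close> has its middle
    term in the fiber, so one of its links is a deleted pair. A translate equal to a deleted pair is
    a translate by zero, hence was deleted already.\<close>
  have "is_congruence n ?D"
  proof (rule is_congruenceI)
    fix u v c assume uv: "(u, v) \<in> ?D" and c: "c \<in> exp_vecs n"
    have "c = 0" if "(u + c, v + c) = (\<alpha>, \<beta>) \<or> (u + c, v + c) = (\<beta>, \<alpha>)"
      using that U(4) mem by auto
    then show "(u + c, v + c) \<in> ?D" using uv K(5)[OF _ c] by auto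
  next
    fix u v x assume "(u, v) \<in> ?D" "(v, x) \<in> ?D"
    then show "(u, x) \<in> ?D" using fib fib' K(4) by blast
  qed (use K ne in blast)+
  moreover have "\<rho>' \<subseteq> ?D"
    using is_presentation_subset_kernel[OF \<rho>'] no by blast
  ultimately have "?K \<subseteq> ?D"
    using \<rho>' unfolding is_presentation_def by (metis hull_minimal)
  then show False using ker by blast
qed

lemma uniform_presentation_minimal:
  assumes "uniform_presentation n a \<rho>"
  shows "minimal_presentation n a \<rho>"
  unfolding minimal_presentation_def
proof (intro conjI allI impI notI)
  fix \<rho>' assume "\<rho>' \<subset> \<rho>" "is_presentation n a \<rho>'"
  then show False
    using uniform_presentation_subset[OF assms] uniform_presentationD(2)[OF assms] by blast
qed (rule uniform_presentationD(1)[OF assms])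

text \<open>The part of \<open>\<rho>'\<close> shared with \<open>\<rho>\<close> up to orientation
  contains every relation of \<open>\<rho>\<close> and so already presents the semigroup. Minimality
  of \<open>\<rho>'\<close> leaves no room for anything else.\<close>

lemma uniform_presentation_unique:
  assumes \<rho>: "uniform_presentation n a \<rho>" and \<rho>': "minimal_presentation n a \<rho>'"
  shows "\<rho>' \<union> \<rho>'\<inverse> = \<rho> \<union> \<rho>\<inverse>"
proof -
  have pres: "is_presentation n a \<rho>'"
    using \<rho>' by (simp add: minimal_presentation_def)
  note ker = is_presentation_subset_kernel[OF pres]
  have sub: "\<rho> \<subseteq> \<rho>' \<union> \<rho>'\<inverse>" by (rule uniform_presentation_subset[OF \<rho> pres])
  let ?R = "\<rho>' \<inter> (\<rho> \<union> \<rho>\<inverse>)"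
  have "?R \<subseteq> exp_vecs n \<times> exp_vecs n"
    using ker kernel_congruence_subset by blast
  note H = is_congruenceD(3)[OF is_congruence_hull[OF this]]
  have "\<rho> \<subseteq> is_congruence n hull ?R"
  proof clarify
    fix \<alpha> \<beta> assume "(\<alpha>, \<beta>) \<in> \<rho>"
    then have "(\<alpha>, \<beta>) \<in> ?R \<or> (\<beta>, \<alpha>) \<in> ?R" using sub by blast
    then show "(\<alpha>, \<beta>) \<in> is_congruence n hull ?R" using H hull_inc by metis
  qed
  then have "is_presentation n a ?R"
    using is_presentation_transfer[OF uniform_presentationD(1)[OF \<rho>]] ker by blast
  then have "\<not> ?R \<subset> \<rho>'" using \<rho>' unfolding minimal_presentation_def by blast
  then show ?thesis using sub by blast
qed

lemma uniform_presentation_uniquely_presented: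
  assumes "uniform_presentation n a \<rho>"
  shows "uniquely_presented n a"
  unfolding uniquely_presented_def
  using uniform_presentation_minimal[OF assms] uniform_presentation_unique[OF assms] by blast

text \<open>Replaces the arbitrary minimal presentation in the definition of \<open>Betti\<close> by
  the fixed \<open>\<rho>\<close>; the pair may have to be reversed.\<close>

lemma uniform_presentation_Betti:
  assumes \<rho>: "uniform_presentation n a \<rho>" and b: "b \<in> Betti n a"
  obtains \<alpha> \<beta> where "(\<alpha>, \<beta>) \<in> \<rho>" "factor_map n a \<alpha> = b" "factor_map n a \<beta> = b"
proof -
  obtain \<alpha> \<beta> \<rho>' where *: "b = factor_map n a \<alpha>" "minimal_presentation n a \<rho>'" "(\<alpha>, \<beta>) \<in> \<rho>'"
    using b by (auto simp: Betti_def)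
  have "(\<alpha>, \<beta>) \<in> \<rho> \<or> (\<beta>, \<alpha>) \<in> \<rho>"
    using uniform_presentation_unique[OF \<rho> *(2)] *(3) by blast
  moreover have "factor_map n a \<beta> = factor_map n a \<alpha>"
    if "(\<alpha>, \<beta>) \<in> \<rho> \<or> (\<beta>, \<alpha>) \<in> \<rho>"
    using that is_presentation_subset_kernel[OF uniform_presentationD(1)[OF \<rho>]]
    by (auto simp: kernel_congruence_def)
  ultimately show thesis using that *(1) by metis
qed

section \<open>Factorizations and the order on Betti elements\<close>

lemma factor_map_single:
  assumes "i < n"
  shows "factor_map n a (Poly_Mapping.single i k) = frag_cmul (int k) (a i)"
proof -
  have "factor_map n a (Poly_Mapping.single i k) =
      (\<Sum>j<n. if i = j then frag_cmul (int k) (a j) else 0)"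
    unfolding factor_map_def by (rule sum.cong) (auto simp: lookup_single when_def)
  then show ?thesis using assms by simp
qed

lemma semigroup_of_factor_map:
  assumes "x \<in> semigroup_of n a"
  obtains u where "u \<in> exp_vecs n" "factor_map n a u = x"
proof -
  let ?M = "factor_map n a ` exp_vecs n"
  have "is_submonoid ?M"
    unfolding is_submonoid_def
  proof (intro conjI ballI)
    have "factor_map n a 0 = 0" by (simp add: factor_map_def)
    then show "0 \<in> ?M" by (metis exp_vecs_zero imageI)
  qed (auto simp: factor_map_add[symmetric])
  moreover have "a ` {..<n} \<subseteq> ?M"
  proof clarify
    fix i assume "i < n"
    then have "a i = factor_map n a (Poly_Mapping.single i 1)"
      by (simp add: factor_map_single)
    moreover have "Poly_Mapping.single i 1 \<in> exp_vecs n"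
      using \<open>i < n\<close> by (simp add: exp_vecs_def)
    ultimately show "a i \<in> ?M" by blast
  qed
  ultimately have "semigroup_of n a \<subseteq> ?M"
    unfolding semigroup_of_def by (metis hull_minimal)
  then show thesis using assms that by blast
qed

text \<open>Let \<open>z\<close> be a factorization of \<open>b - c\<close>. Adding \<open>z\<close>
  to the two distinct factorizations of \<open>c\<close> gives two distinct factorizations of
  \<open>b\<close>, hence all of them. Both then contain the nonzero summand \<open>z\<close>,
  against disjointness.\<close>

lemma uniform_presentation_Betti_minimal:
  assumes \<rho>: "uniform_presentation n a \<rho>" and b: "b \<in> Betti n a"
  shows "Betti_minimal n a b"
  unfolding Betti_minimal_def
proof (intro conjI ballI notI b)
  fix c assume c: "c \<in> Betti n a" and gr: "semigroup_greater (semigroup_of n a) b c"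
  note U = uniform_presentationD[OF \<rho>]
  have "b - c \<in> semigroup_of n a" using gr by (simp add: semigroup_greater_def)
  then obtain z where z: "z \<in> exp_vecs n" "factor_map n a z = b - c"
    by (rule semigroup_of_factor_map)
  have "z \<noteq> 0"
    using gr z(2) by (auto simp: semigroup_greater_def factor_map_def)
  obtain \<alpha> \<beta> where b: "(\<alpha>, \<beta>) \<in> \<rho>" "factor_map n a \<alpha> = b" "factor_map n a \<beta> = b"
    using uniform_presentation_Betti[OF \<rho> b] by blast
  obtain \<alpha>' \<beta>' where c: "(\<alpha>', \<beta>') \<in> \<rho>" "factor_map n a \<alpha>' = c" "factor_map n a \<beta>' = c"
    using uniform_presentation_Betti[OF \<rho> c] by blast
  have "\<alpha>' \<noteq> \<beta>'" using U(2) c(1) by blast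
  moreover have "\<alpha>' \<in> exp_vecs n" "\<beta>' \<in> exp_vecs n"
    using c(1) U(1) unfolding is_presentation_def by blast+
  then have "\<alpha>' + z = \<alpha> \<or> \<alpha>' + z = \<beta>" "\<beta>' + z = \<alpha> \<or> \<beta>' + z = \<beta>"
    using U(3)[OF b(1)] b(2) c z by (auto simp: factor_map_add)
  ultimately have "\<exists>x y. (x + z, y + z) \<in> \<rho>"
    using b(1) by auto
  then show False using U(4) \<open>z \<noteq> 0\<close> by blast
qed

section \<open>Ideals generated by binomials\<close>

lemma polys_zero [simp]: "0 \<in> polys n"
  and polys_one [simp]: "1 \<in> polys n"
  by (simp_all add: polys_def)

lemma polys_single [simp]: "u \<in> exp_vecs n \<Longrightarrow> Poly_Mapping.single u c \<in> polys n"
  by (simp add: polys_def)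

lemma polys_add: "p \<in> polys n \<Longrightarrow> q \<in> polys n \<Longrightarrow> p + q \<in> polys n"
  unfolding polys_def using keys_add[of p q] by blast

lemma polys_mult: "p \<in> polys n \<Longrightarrow> q \<in> polys n \<Longrightarrow> p * q \<in> polys n"
  unfolding polys_def using keys_mult[of p q] by fastforce

lemma ideal_genI:
  "finite B \<Longrightarrow> B \<subseteq> F \<Longrightarrow> \<forall>f\<in>B. q f \<in> polys n \<Longrightarrow> (\<Sum>f\<in>B. q f * f) \<in> ideal_gen n F"
  unfolding ideal_gen_def by blast

lemma ideal_gen_zero: "0 \<in> ideal_gen n F"
  unfolding ideal_gen_def by (rule CollectI, rule exI[of _ "{}"]) simp

lemma ideal_gen_incl: "f \<in> F \<Longrightarrow> f \<in> ideal_gen n F"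
  unfolding ideal_gen_def
  by (rule CollectI, rule exI[of _ "{f}"], rule exI[of _ "\<lambda>_. 1"]) simp

lemma ideal_gen_add:
  assumes "p \<in> ideal_gen n F" "q \<in> ideal_gen n F"
  shows "p + q \<in> ideal_gen n F"
proof -
  obtain B r where B: "p = (\<Sum>f\<in>B. r f * f)" "finite B" "B \<subseteq> F" "\<forall>f\<in>B. r f \<in> polys n"
    using assms(1) by (auto simp: ideal_gen_def)
  obtain C s where C: "q = (\<Sum>f\<in>C. s f * f)" "finite C" "C \<subseteq> F" "\<forall>f\<in>C. s f \<in> polys n"
    using assms(2) by (auto simp: ideal_gen_def)
  \<comment> \<open>The two sums run over different finite sets of generators, so each family of
    coefficients is extended by zero to the union.\<close>
  let ?t = "\<lambda>f. (if f \<in> B then r f else 0) + (if f \<in> C then s f else 0)"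
  have "p = (\<Sum>f\<in>B \<union> C. (if f \<in> B then r f else 0) * f)"
    unfolding B(1) by (rule sum.mono_neutral_cong_left) (use B C in auto)
  moreover have "q = (\<Sum>f\<in>B \<union> C. (if f \<in> C then s f else 0) * f)"
    unfolding C(1) by (rule sum.mono_neutral_cong_left) (use B C in auto)
  ultimately have "p + q = (\<Sum>f\<in>B \<union> C. ?t f * f)"
    by (simp add: sum.distrib distrib_right)
  moreover have "\<forall>f\<in>B \<union> C. ?t f \<in> polys n"
    using B(4) C(4) by (auto intro: polys_add)
  ultimately show ?thesis
    using ideal_genI[of "B \<union> C" F ?t n] B C by simp
qed

lemma ideal_gen_mult:
  assumes "p \<in> ideal_gen n F" "q \<in> polys n"
  shows "q * p \<in> ideal_gen n F"
proof -
  obtain B r where B: "p = (\<Sum>f\<in>B. r f * f)" "finite B" "B \<subseteq> F" "\<forall>f\<in>B. r f \<in> polys n"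
    using assms(1) by (auto simp: ideal_gen_def)
  have "q * p = (\<Sum>f\<in>B. (q * r f) * f)"
    unfolding B(1) by (simp add: sum_distrib_left mult.assoc)
  moreover have "\<forall>f\<in>B. q * r f \<in> polys n"
    using B(4) assms(2) by (auto intro: polys_mult)
  ultimately show ?thesis
    using ideal_genI[of B F "\<lambda>f. q * r f" n] B by simp
qed

lemma ideal_gen_minimal:
  assumes "F \<subseteq> ideal_gen n F'"
  shows "ideal_gen n F \<subseteq> ideal_gen n F'"
proof
  fix p assume "p \<in> ideal_gen n F"
  then obtain B r where B: "p = (\<Sum>f\<in>B. r f * f)" "finite B" "B \<subseteq> F" "\<forall>f\<in>B. r f \<in> polys n"
    by (auto simp: ideal_gen_def)
  have "(\<Sum>f\<in>B. r f * f) \<in> ideal_gen n F'"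
    using B(2-4)
  proof (induction B rule: finite_induct)
    case (insert f B)
    then have "r f * f \<in> ideal_gen n F'" using assms by (auto intro: ideal_gen_mult)
    with insert show ?case by (simp add: ideal_gen_add)
  qed (simp add: ideal_gen_zero)
  then show "p \<in> ideal_gen n F'" using B(1) by simp
qed

lemma ideal_gen_mono: "F \<subseteq> F' \<Longrightarrow> ideal_gen n F \<subseteq> ideal_gen n F'"
  by (rule ideal_gen_minimal) (auto intro: ideal_gen_incl)

text \<open>The bridge from ideals to congruences: multiplication by \<open>-1\<close> gives
  symmetry, telescoping sums give transitivity, and multiplication by a monomial gives
  translation.\<close>

lemma ideal_gen_binomial_congruence:
  "is_congruence n {(u, v). u \<in> exp_vecs n \<and> v \<in> exp_vecs n \<and>
     (Poly_Mapping.single u 1 - Poly_Mapping.single v 1 :: 'k::field mpol) \<in> ideal_gen n F}"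
proof (rule is_congruenceI; clarsimp simp: ideal_gen_zero)
  let ?b = "\<lambda>u v. Poly_Mapping.single u 1 - Poly_Mapping.single v 1 :: 'k mpol"
  fix u v assume uv: "u \<in> exp_vecs n" "v \<in> exp_vecs n" "?b u v \<in> ideal_gen n F"
  have "Poly_Mapping.single 0 (- 1) * ?b u v = ?b v u"
    by (simp add: right_diff_distrib mult_single single_uminus)
  moreover have "Poly_Mapping.single 0 (- 1) * ?b u v \<in> ideal_gen n F"
    using uv by (intro ideal_gen_mult) auto
  ultimately show "?b v u \<in> ideal_gen n F" by simp
  {
    fix x assume "?b v x \<in> ideal_gen n F"
    with uv have "?b u v + ?b v x \<in> ideal_gen n F" by (intro ideal_gen_add)
    then show "?b u x \<in> ideal_gen n F" by simp
  }
  fix c assume c: "c \<in> exp_vecs n"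
  have "Poly_Mapping.single c 1 * ?b u v = ?b (u + c) (v + c)"
    by (simp add: right_diff_distrib mult_single add.commute)
  moreover have "Poly_Mapping.single c 1 * ?b u v \<in> ideal_gen n F"
    using uv c by (intro ideal_gen_mult) auto
  ultimately show "?b (u + c) (v + c) \<in> ideal_gen n F" by simp
qed

lemma keys_binomial:
  fixes c :: "'k::field"
  assumes "u \<noteq> v" "c \<noteq> 0"
  shows "Poly_Mapping.keys (Poly_Mapping.single u c - Poly_Mapping.single v c) = {u, v}"
  using assms by (auto simp: in_keys_iff lookup_minus lookup_single when_def split: if_splits)

section \<open>Fibers and monomials in toric ideals\<close>

text \<open>A linear functional that vanishes on the toric ideal when \<open>h\<close> is the factorization map.\<close>

definition fiber_sum :: "('a \<Rightarrow> 'b) \<Rightarrow> 'b \<Rightarrow> ('a \<Rightarrow>\<^sub>0 'k::field) \<Rightarrow> 'k" where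
  "fiber_sum h b p = (\<Sum>u\<in>Poly_Mapping.keys p. Poly_Mapping.lookup p u when h u = b)"

lemma fiber_sum_superset:
  assumes "finite A" "Poly_Mapping.keys p \<subseteq> A"
  shows "fiber_sum h b p = (\<Sum>u\<in>A. Poly_Mapping.lookup p u when h u = b)"
  unfolding fiber_sum_def
  by (rule sum.mono_neutral_left) (use assms in \<open>auto simp: in_keys_iff\<close>)

lemma fiber_sum_add: "fiber_sum h b (p + q) = fiber_sum h b p + fiber_sum h b q"
proof -
  let ?A = "Poly_Mapping.keys p \<union> Poly_Mapping.keys q"
  have "fiber_sum h b r = (\<Sum>u\<in>?A. Poly_Mapping.lookup r u when h u = b)"
    if "r \<in> {p, q, p + q}" for r
    by (rule fiber_sum_superset) (use that keys_add[of p q] in auto)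
  then show ?thesis
    by (simp add: lookup_add sum.distrib[symmetric] when_add_distrib)
qed

lemma fiber_sum_single: "fiber_sum h b (Poly_Mapping.single u c) = (c when h u = b)"
  by (cases "c = 0") (simp_all add: fiber_sum_def)

lemma fiber_sum_diff: "fiber_sum h b (p - q) = fiber_sum h b p - fiber_sum h b q"
  using fiber_sum_add[of h b "p - q" q] by (simp add: algebra_simps)

lemma mpol_induct [case_names zero add]:
  fixes P :: "'k::field mpol \<Rightarrow> bool"
  assumes "P 0" and "\<And>u c p. P p \<Longrightarrow> P (Poly_Mapping.single u c + p)"
  shows "P p"
proof (induction p rule: update_induct)
  case const
  show ?case by (rule assms(1))
next
  case (update f a b)
  \<comment> \<open>Here \<open>a\<close> lies outside the support of \<open>f\<close>, so
    overwriting its zero coefficient is an addition.\<close>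
  have "Poly_Mapping.update a b f = Poly_Mapping.single a b + f"
    using update(1)
    by (intro poly_mapping_eqI) (auto simp: lookup_update lookup_add lookup_single when_def in_keys_iff)
  then show ?case using assms(2)[OF update(3)] by simp
qed

lemma toric_ideal_fiber_sum:
  fixes p :: "'k::field mpol"
  assumes "p \<in> toric_ideal n a"
  shows "fiber_sum (factor_map n a) b p = 0"
proof -
  let ?\<phi> = "fiber_sum (factor_map n a) b :: 'k mpol \<Rightarrow> 'k"
  \<comment> \<open>By linearity in \<open>q\<close> it suffices to multiply by one term. This
    translates both exponents equally, so they stay in a common fiber and their coefficients
    cancel.\<close>
  have *: "?\<phi> (q * (Poly_Mapping.single u 1 - Poly_Mapping.single v 1)) = 0"
    if "factor_map n a u = factor_map n a v" for q u v
  proof (induction q rule: mpol_induct)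
    case (add x c q)
    have "?\<phi> (Poly_Mapping.single x c * (Poly_Mapping.single u 1 - Poly_Mapping.single v 1)) = 0"
      using that
      by (simp add: right_diff_distrib mult_single fiber_sum_diff fiber_sum_single factor_map_add)
    then show ?case using add by (simp add: distrib_right fiber_sum_add)
  qed (simp add: fiber_sum_def)
  obtain B r where B: "p = (\<Sum>f\<in>B. r f * f)" "finite B"
    "B \<subseteq> {Poly_Mapping.single u 1 - Poly_Mapping.single v 1 |u v.
      u \<in> exp_vecs n \<and> v \<in> exp_vecs n \<and> factor_map n a u = factor_map n a v}"
    using assms unfolding toric_ideal_def ideal_gen_def by blast
  have "?\<phi> (\<Sum>f\<in>B. r f * f) = 0"
    using B(2,3)
  proof (induction B rule: finite_induct)
    case (insert f B)
    then have "?\<phi> (r f * f) = 0" using * by auto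
    with insert show ?case by (simp add: fiber_sum_add)
  qed (simp add: fiber_sum_def)
  then show ?thesis using B(1) by simp
qed

text \<open>If the two fibers differed, the functional at the fiber of \<open>u\<close> would see
  only the coefficient \<open>c\<close> instead of vanishing.\<close>

lemma toric_ideal_binomial:
  fixes c :: "'k::field"
  assumes "Poly_Mapping.single u c - Poly_Mapping.single v c \<in> toric_ideal n a" "c \<noteq> 0"
  shows "factor_map n a u = factor_map n a v"
proof (rule ccontr)
  assume "factor_map n a u \<noteq> factor_map n a v"
  then have "fiber_sum (factor_map n a) (factor_map n a u)
      (Poly_Mapping.single u c - Poly_Mapping.single v c) = c"
    by (simp add: fiber_sum_diff fiber_sum_single)
  then show False
    using toric_ideal_fiber_sum[OF assms(1)] assms(2) by metis
qed

text \<open>The exponent \<open>x\<close> must survive in some summand \<open>q f * f\<close>, and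
  all exponents of a multiple of \<open>x^u\<close> are of the form \<open>u + k\<close>.\<close>

lemma ideal_gen_monomial:
  fixes L :: "expvec set"
  assumes "Poly_Mapping.single x (1 :: 'k::field) \<in> ideal_gen n {Poly_Mapping.single u 1 |u. u \<in> L}"
  obtains k u where "u \<in> L" "x = u + k"
proof -
  obtain B q where B: "Poly_Mapping.single x (1 :: 'k) = (\<Sum>f\<in>B. q f * f)"
    "B \<subseteq> {Poly_Mapping.single u 1 |u. u \<in> L}" "finite B"
    using assms unfolding ideal_gen_def by blast
  have "x \<in> Poly_Mapping.keys (\<Sum>f\<in>B. q f * f)"
    unfolding B(1)[symmetric] by simp
  then have "(\<Sum>f\<in>B. Poly_Mapping.lookup (q f * f) x) \<noteq> 0"
    by (simp add: in_keys_iff lookup_sum)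
  then obtain f where f: "f \<in> B" "Poly_Mapping.lookup (q f * f) x \<noteq> 0"
    by (rule sum.not_neutral_contains_not_neutral)
  then have "x \<in> Poly_Mapping.keys (q f * f)" by (simp add: in_keys_iff)
  with f(1) obtain u where u: "u \<in> L" "x \<in> Poly_Mapping.keys (q f * Poly_Mapping.single u 1)"
    using B(2) by blast
  obtain k where "x = u + k"
    using keys_mult[of "q f" "Poly_Mapping.single u 1"] u(2) by (auto simp: add.commute)
  with u(1) show thesis by (rule that)
qed

section \<open>Binomial Groebner bases as presentations\<close>

locale ordered_binomials =
  fixes n :: nat and a :: "nat \<Rightarrow> intvec" and w :: "nat \<Rightarrow> nat"
    and G :: "'k::field mpol set" and r :: "expvec rel"
  assumes mingen: "minimal_generating_set n (toric_ideal n a) G"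
    and mon: "monomial_order n r"
    and groebner: "groebner_basis n (refined_order n w r) (toric_ideal n a) G"
begin

definition lt :: "expvec \<Rightarrow> expvec \<Rightarrow> bool" where
  "lt u v \<longleftrightarrow> u \<noteq> v \<and> (u, v) \<in> refined_order n w r"

text \<open>The rewriting rules read off from \<open>G\<close>, from leading to trailing exponent.
  The free scalar \<open>c\<close> absorbs the normalization and the sign of each binomial.\<close>

definition pairs :: "expvec rel" where
  "pairs = {(u, v). lt v u \<and> (\<exists>c. c \<noteq> 0 \<and> Poly_Mapping.single u c - Poly_Mapping.single v c \<in> G)}"

lemma r_order: "well_order_on (exp_vecs n) r"
  and r_add: "(u, v) \<in> r \<Longrightarrow> c \<in> exp_vecs n \<Longrightarrow> (u + c, v + c) \<in> r"
  using mon by (auto simp: monomial_order_def)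

lemma antisym_r: "antisym r" and wf_r: "wf (r - Id)" and refl_r: "refl_on (exp_vecs n) r"
  and total_r: "total_on (exp_vecs n) r"
  using r_order by (auto simp: order_on_defs)

lemma lt_exp_vecs: "lt u v \<Longrightarrow> u \<in> exp_vecs n" "lt u v \<Longrightarrow> v \<in> exp_vecs n"
  and lt_weight: "lt u v \<Longrightarrow> weight n w u \<le> weight n w v"
  by (auto simp: lt_def refined_order_def)

lemma lt_asym: "lt u v \<Longrightarrow> \<not> lt v u"
  using antisym_r by (auto simp: lt_def refined_order_def antisym_def)

lemma lt_linear: "u \<in> exp_vecs n \<Longrightarrow> v \<in> exp_vecs n \<Longrightarrow> u = v \<or> lt u v \<or> lt v u"
  using total_r by (auto simp: lt_def refined_order_def total_on_def)

lemma lt_add: "lt u v \<Longrightarrow> c \<in> exp_vecs n \<Longrightarrow> lt (u + c) (v + c)"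
  by (auto simp: lt_def refined_order_def weight_add intro: r_add)

text \<open>Weights are natural numbers, so the strict order embeds into a lexicographic product of
  two well-founded orders. This makes rewriting terminate.\<close>

lemma wf_lt: "wf {(u, v). lt u v}"
proof (rule wf_subset)
  show "wf (inv_image (less_than <*lex*> (r - Id)) (\<lambda>u. (weight n w u, u)))"
    using wf_r by (intro wf_inv_image wf_lex_prod wf_less_than)
qed (auto simp: lt_def refined_order_def)

lemma lead_exp_binomial:
  assumes "lt v u" "c \<noteq> (0 :: 'k)"
  shows "lead_exp (refined_order n w r) (Poly_Mapping.single u c - Poly_Mapping.single v c) = u"
proof -
  have k: "Poly_Mapping.keys (Poly_Mapping.single u c - Poly_Mapping.single v c) = {u, v}"
    using assms by (intro keys_binomial) (auto simp: lt_def)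
  have "(u, u) \<in> refined_order n w r"
    using lt_exp_vecs(2)[OF assms(1)] refl_r by (auto simp: refined_order_def refl_on_def)
  moreover have "(v, u) \<in> refined_order n w r" "(u, v) \<notin> refined_order n w r"
    using assms(1) lt_asym[OF assms(1)] by (auto simp: lt_def)
  ultimately show ?thesis
    unfolding lead_exp_def k by (intro the_equality) auto
qed

lemma binomial_lead:
  assumes "g \<in> G"
  obtains u v where "(u, v) \<in> pairs" "lead_exp (refined_order n w r) g = u"
proof -
  have "g \<in> binomials n" using assms mingen by (auto simp: minimal_generating_set_def)
  then obtain u v c where g: "g = Poly_Mapping.single u c - Poly_Mapping.single v c"
    "u \<in> exp_vecs n" "v \<in> exp_vecs n" "u \<noteq> v" "c \<noteq> 0"
    by (auto simp: binomials_def)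
  \<comment> \<open>Negating the scalar exchanges the two terms, so the larger exponent can always
    be written first.\<close>
  have g': "g = Poly_Mapping.single v (- c) - Poly_Mapping.single u (- c)"
    by (simp add: g(1) single_uminus)
  consider "lt v u" | "lt u v" using lt_linear g by blast
  then show thesis
  proof cases
    case 1
    then have "(u, v) \<in> pairs" using g(1,5) assms by (auto simp: pairs_def)
    then show thesis using that lead_exp_binomial[OF 1 g(5)] g(1) by simp
  next
    case 2
    have c: "- c \<noteq> 0" using g(5) by simp
    then have "(v, u) \<in> pairs" using 2 g' assms unfolding pairs_def by blast
    then show thesis using that lead_exp_binomial[OF 2 c] g' by simp
  qed
qed

section \<open>Rewriting along the Groebner basis\<close>

text \<open>The binomial of \<open>x\<close> and \<open>y\<close> lies in the toric ideal and has
  leading exponent \<open>x\<close>. By the Groebner property the monomial of \<open>x\<close> lies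
  in the ideal of the leading monomials of \<open>G\<close>, so one of them divides it.\<close>

lemma reduction:
  assumes "(x, y) \<in> kernel_congruence n a" "lt y x"
  obtains u v k where "(u, v) \<in> pairs" "k \<in> exp_vecs n" "x = u + k"
proof -
  let ?R = "refined_order n w r"
  let ?f = "Poly_Mapping.single x 1 - Poly_Mapping.single y 1 :: 'k mpol"
  have "?f \<in> toric_ideal n a"
    unfolding toric_ideal_def using assms(1)
    by (intro ideal_gen_incl) (auto simp: kernel_congruence_def)
  moreover have "?f \<noteq> 0"
    using keys_binomial[of x y "1 :: 'k"] assms(2) by (auto simp: lt_def)
  ultimately have "Poly_Mapping.single (lead_exp ?R ?f) (1 :: 'k) \<in>
      initial_ideal n ?R (toric_ideal n a :: 'k mpol set)"
    unfolding initial_ideal_def by (intro ideal_gen_incl) blast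
  then have "Poly_Mapping.single x (1 :: 'k) \<in> initial_ideal n ?R G"
    using groebner lead_exp_binomial[OF assms(2), of 1] by (simp add: groebner_basis_def)
  also have "initial_ideal n ?R G \<subseteq>
      ideal_gen n {Poly_Mapping.single u 1 |u. u \<in> lead_exp ?R ` G}"
    unfolding initial_ideal_def by (rule ideal_gen_mono) auto
  finally obtain u k where u: "u \<in> lead_exp ?R ` G" "x = u + k"
    by (rule ideal_gen_monomial)
  then obtain g where "g \<in> G" "lead_exp ?R g = u" by blast
  then obtain v where "(u, v) \<in> pairs" using binomial_lead[of g] by metis
  moreover have "k \<in> exp_vecs n"
    using u(2) lt_exp_vecs(2)[OF assms(2)] by simp
  ultimately show thesis using that u(2) by blast
qed

lemma pairs_kernel: "pairs \<subseteq> kernel_congruence n a"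
proof clarify
  fix u v assume "(u, v) \<in> pairs"
  then obtain c :: 'k where c: "lt v u" "c \<noteq> 0" "Poly_Mapping.single u c - Poly_Mapping.single v c \<in> G"
    by (auto simp: pairs_def)
  then have "Poly_Mapping.single u c - Poly_Mapping.single v c \<in> toric_ideal n a"
    using groebner by (auto simp: groebner_basis_def)
  then have "factor_map n a u = factor_map n a v"
    using toric_ideal_binomial c(2) by blast
  then show "(u, v) \<in> kernel_congruence n a"
    using lt_exp_vecs[OF c(1)] by (simp add: kernel_congruence_def)
qed

text \<open>Rewriting the larger member of a kernel pair until the two meet. Since
  \<open>step\<close> uses rules only in their decreasing direction, the rule also supports
  arguments that keep track of weights.\<close>

lemma kernel_induct [consumes 1, case_names refl sym step]:
  assumes "(x, y) \<in> kernel_congruence n a"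
    and refl: "\<And>x. x \<in> exp_vecs n \<Longrightarrow> P x x"
    and sym: "\<And>x y. P x y \<Longrightarrow> P y x"
    and step: "\<And>u v c y. (u, v) \<in> pairs \<Longrightarrow> c \<in> exp_vecs n \<Longrightarrow> P (v + c) y \<Longrightarrow> P (u + c) y"
  shows "P x y"
proof -
  have main: "P x y" if "(x, y) \<in> kernel_congruence n a" "lt y x" for x y
    using that
  proof (induction x arbitrary: y rule: wf_induct_rule[OF wf_lt])
    case (1 x)
    obtain u v k where u: "(u, v) \<in> pairs" "k \<in> exp_vecs n" "x = u + k"
      using reduction[OF 1(2,3)] by blast
    note K = is_congruenceD[OF is_congruence_kernel[of n a]]
    have "lt v u" using u(1) by (simp add: pairs_def)
    then have lt: "lt (v + k) x" using lt_add u by simp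
    have "(u, v) \<in> kernel_congruence n a" using u(1) pairs_kernel by blast
    then have "(x, v + k) \<in> kernel_congruence n a" using K(5) u by blast
    then have ker: "(v + k, y) \<in> kernel_congruence n a" using 1(2) K(3,4) by blast
    consider "v + k = y" | "lt y (v + k)" | "lt (v + k) y"
      using lt_linear lt_exp_vecs 1(3) lt by blast
    then have "P (v + k) y"
    proof cases
      case 1
      then show ?thesis using refl lt_exp_vecs(1)[OF lt] by simp
    next
      case 2
      then show ?thesis using 1(1) lt ker by blast
    next
      case 3
      \<comment> \<open>Now \<open>y\<close> is the larger member; it is still below
        \<open>x\<close>, so the induction hypothesis applies at \<open>y\<close> and
        \<open>sym\<close> turns the result round.\<close>
      then show ?thesis using 1(1)[of y "v + k"] 1(3) K(3)[OF ker] sym by blast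
    qed
    then show ?case using step u by blast
  qed
  have "x \<in> exp_vecs n" "y \<in> exp_vecs n"
    using assms(1) by (auto simp: kernel_congruence_def)
  then consider "x = y" | "lt y x" | "lt x y" using lt_linear by blast
  then show ?thesis
    using main assms(1) refl sym is_congruenceD(3)[OF is_congruence_kernel assms(1)]
      \<open>x \<in> exp_vecs n\<close> by metis
qed

lemma pairs_presentation: "is_presentation n a pairs"
proof (rule is_presentationI[OF pairs_kernel])
  have "is_congruence n (is_congruence n hull pairs)"
    using pairs_kernel kernel_congruence_subset by (blast intro: is_congruence_hull)
  note H = is_congruenceD[OF this]
  fix x y assume "(x, y) \<in> kernel_congruence n a"
  then show "(x, y) \<in> is_congruence n hull pairs"
  proof (induction rule: kernel_induct)
    case (step u v c y)
    have "(u + c, v + c) \<in> is_congruence n hull pairs"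
      using step by (intro H(5) hull_inc)
    then show ?case using step H(4) by blast
  qed (blast intro: H)+
qed

lemma finite_pairs: "finite pairs"
proof (rule finite_subset)
  show "finite (\<Union>g\<in>G. Poly_Mapping.keys g \<times> Poly_Mapping.keys g)"
    using groebner by (auto simp: groebner_basis_def)
  show "pairs \<subseteq> (\<Union>g\<in>G. Poly_Mapping.keys g \<times> Poly_Mapping.keys g)"
  proof clarify
    fix u v assume "(u, v) \<in> pairs"
    then obtain c where c: "u \<noteq> v" "c \<noteq> 0" "Poly_Mapping.single u c - Poly_Mapping.single v c \<in> G"
      by (auto simp: pairs_def lt_def)
    show "(u, v) \<in> (\<Union>g\<in>G. Poly_Mapping.keys g \<times> Poly_Mapping.keys g)"
      using keys_binomial[OF c(1,2)] c(3) by (intro UN_I[OF c(3)]) simp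
  qed
qed

text \<open>Minimality passes from \<open>G\<close> to \<open>pairs\<close>: the binomials belonging
  to a smaller presentation would already generate the toric ideal, hence be all of
  \<open>G\<close>, while distinct pairs come from distinct binomials.\<close>

lemma pairs_minimal: "minimal_presentation n a pairs"
  unfolding minimal_presentation_def
proof (intro conjI pairs_presentation allI impI notI)
  fix \<rho> assume \<rho>: "\<rho> \<subset> pairs" "is_presentation n a \<rho>"
  let ?G = "{g \<in> G. \<exists>u v c. (u, v) \<in> \<rho> \<and> c \<noteq> 0 \<and>
    g = Poly_Mapping.single u c - Poly_Mapping.single v c}"
  let ?C = "{(u, v). u \<in> exp_vecs n \<and> v \<in> exp_vecs n \<and>
    (Poly_Mapping.single u 1 - Poly_Mapping.single v 1 :: 'k mpol) \<in> ideal_gen n ?G}"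
  have "\<rho> \<subseteq> ?C"
  proof clarify
    fix u v assume uv: "(u, v) \<in> \<rho>"
    then obtain c :: 'k where c: "lt v u" "c \<noteq> 0"
      "Poly_Mapping.single u c - Poly_Mapping.single v c \<in> G"
      using \<rho>(1) by (auto simp: pairs_def)
    then have "Poly_Mapping.single u c - Poly_Mapping.single v c \<in> ideal_gen n ?G"
      using uv by (intro ideal_gen_incl) auto
    then have "Poly_Mapping.single 0 (inverse c) *
        (Poly_Mapping.single u c - Poly_Mapping.single v c) \<in> ideal_gen n ?G"
      by (rule ideal_gen_mult) simp
    then show "u \<in> exp_vecs n \<and> v \<in> exp_vecs n \<and>
        Poly_Mapping.single u 1 - Poly_Mapping.single v 1 \<in> ideal_gen n ?G"
      using c lt_exp_vecs[OF c(1)] by (simp add: right_diff_distrib mult_single)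
  qed
  then have "is_congruence n hull \<rho> \<subseteq> ?C"
    by (rule hull_minimal) (rule ideal_gen_binomial_congruence)
  then have "kernel_congruence n a \<subseteq> ?C"
    using \<rho>(2) by (simp add: is_presentation_def)
  then have "toric_ideal n a \<subseteq> ideal_gen n ?G"
    unfolding toric_ideal_def
    by (intro ideal_gen_minimal) (auto simp: kernel_congruence_def)
  moreover have "ideal_gen n ?G \<subseteq> toric_ideal n a"
    using mingen ideal_gen_mono[of ?G G n] by (auto simp: minimal_generating_set_def)
  ultimately have "\<not> ?G \<subset> G"
    using mingen unfolding minimal_generating_set_def by blast
  moreover obtain u v where uv: "(u, v) \<in> pairs" "(u, v) \<notin> \<rho>"
    using psubset_imp_ex_mem[OF \<rho>(1)] by auto
  then obtain c :: 'k where c: "lt v u" "c \<noteq> 0"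
    "Poly_Mapping.single u c - Poly_Mapping.single v c \<in> G"
    by (auto simp: pairs_def)
  ultimately obtain u' v' d where d: "(u', v') \<in> \<rho>" "d \<noteq> 0"
    "Poly_Mapping.single u c - Poly_Mapping.single v c =
      Poly_Mapping.single u' d - Poly_Mapping.single v' d"
    by blast
  \<comment> \<open>A binomial determines its pair: the leading exponent is the first component, and
    the support then gives the second.\<close>
  have lt': "lt v' u'" using d(1) \<rho>(1) by (auto simp: pairs_def)
  have "u = u'"
    using lead_exp_binomial[OF c(1,2)] lead_exp_binomial[OF lt' d(2)] d(3) by simp
  moreover have "{u, v} = {u', v'}"
    using keys_binomial[of u v c] keys_binomial[of u' v' d] c lt' d by (auto simp: lt_def)
  ultimately show False using d(1) uv(2) by (auto simp: doubleton_eq_iff)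
qed

end

section \<open>The weighted semigroup\<close>

lemma exp_vecs_mono: "n \<le> m \<Longrightarrow> u \<in> exp_vecs n \<Longrightarrow> u \<in> exp_vecs m"
  by (auto simp: exp_vecs_def)

lemma exp_vecs_Suc_decomp:
  assumes "z \<in> exp_vecs (Suc n)"
  obtains x s where "x \<in> exp_vecs n" "z = x + Poly_Mapping.single n s"
proof
  let ?x = "z - Poly_Mapping.single n (Poly_Mapping.lookup z n)"
  have "i \<notin> Poly_Mapping.keys ?x" if "\<not> i < n" for i
  proof (cases "i = n")
    case False
    with that have "i \<notin> Poly_Mapping.keys z" using assms by (auto simp: exp_vecs_def)
    then show ?thesis by (simp add: lookup_minus in_keys_iff)
  qed (simp add: lookup_minus in_keys_iff)
  then show "?x \<in> exp_vecs n"
    unfolding exp_vecs_def by blast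
  show "z = ?x + Poly_Mapping.single n (Poly_Mapping.lookup z n)"
    by (rule poly_mapping_eqI) (simp add: lookup_add lookup_minus lookup_single when_def)
qed

lemma single_in_exp_vecs_Suc [simp]: "Poly_Mapping.single n s \<in> exp_vecs (Suc n)"
  by (simp add: exp_vecs_def)

lemma lookup_exp_vecs: "x \<in> exp_vecs n \<Longrightarrow> Poly_Mapping.lookup x n = 0"
  by (auto simp: exp_vecs_def in_keys_iff)

lemma factor_map_weighted:
  assumes "x \<in> exp_vecs n"
  shows "factor_map (Suc n) (weighted_gens d n a w) (x + Poly_Mapping.single n s) =
    factor_map n a x + frag_cmul (int (weight n w x + s)) (frag_of d)"
proof -
  have cmul: "frag_cmul (sum f A) z = (\<Sum>i\<in>A. frag_cmul (f i) z)" for f :: "nat \<Rightarrow> int" and A and z :: intvec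
    by (rule poly_mapping_eqI) (simp add: lookup_sum sum_distrib_right)
  have "factor_map (Suc n) (weighted_gens d n a w) x =
      (\<Sum>i<n. frag_cmul (int (Poly_Mapping.lookup x i)) (a i + frag_cmul (int (w i)) (frag_of d)))"
    unfolding factor_map_def by (simp add: lookup_exp_vecs[OF assms] weighted_gens_def)
  also have "\<dots> = factor_map n a x + frag_cmul (int (weight n w x)) (frag_of d)"
    by (simp add: factor_map_def weight_def frag_cmul_distrib2 sum.distrib cmul mult.commute)
  finally show ?thesis
    by (simp add: factor_map_add factor_map_single weighted_gens_def frag_cmul_distrib add.assoc)
qed

text \<open>The \<open>a i\<close> vanish in coordinate \<open>d\<close>, so that coordinate
  isolates the equation of weights. In a fixed fiber of the weighted semigroup the exponent of
  \<open>t\<close> is thus determined by \<open>x\<close>, which embeds the fiber into one of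
  \<open>S\<close>.\<close>

lemma factor_map_weighted_eq_iff:
  assumes a: "a ` {..<n} \<subseteq> int_vecs d" and "x \<in> exp_vecs n" "y \<in> exp_vecs n"
  shows "factor_map (Suc n) (weighted_gens d n a w) (x + Poly_Mapping.single n s) =
      factor_map (Suc n) (weighted_gens d n a w) (y + Poly_Mapping.single n t) \<longleftrightarrow>
    factor_map n a x = factor_map n a y \<and> weight n w x + s = weight n w y + t"
    (is "?L \<longleftrightarrow> ?R")
proof
  have "Poly_Mapping.lookup (a i) d = 0" if "i < n" for i
    proof -
    have "a i \<in> int_vecs d" using a that by blast
    then show ?thesis by (auto simp: int_vecs_def in_keys_iff)
  qed
  then have zero: "Poly_Mapping.lookup (factor_map n a u) d = 0" for u
    by (simp add: factor_map_def lookup_sum)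
  assume L: ?L
  then have "int (weight n w x + s) = int (weight n w y + t)"
    using zero unfolding factor_map_weighted[OF assms(2)] factor_map_weighted[OF assms(3)]
    by (metis add_0 lookup_add lookup_frag_cmul lookup_frag_of mult.right_neutral)
  with L show ?R
    unfolding factor_map_weighted[OF assms(2)] factor_map_weighted[OF assms(3)] by simp
qed (simp only: factor_map_weighted assms)

lemma add_single_eq_iff:
  assumes "x \<in> exp_vecs n" "y \<in> exp_vecs n"
  shows "x + Poly_Mapping.single n s = y + Poly_Mapping.single n t \<longleftrightarrow> x = y \<and> s = t"
proof
  assume eq: "x + Poly_Mapping.single n s = y + Poly_Mapping.single n t"
  then have "s = t"
    using lookup_exp_vecs assms by (metis add_0 lookup_add lookup_single_eq)
  with eq show "x = y \<and> s = t" by simp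
qed simp

section \<open>Homogenized relations\<close>

context ordered_binomials
begin

text \<open>On \<open>pairs\<close> the natural subtraction is exact: the order refines
  \<open>w\<close>, so the leading side has at least the weight of the trailing side, and
  \<open>t\<close> is needed on the trailing side only.\<close>

definition homog :: "expvec \<times> expvec \<Rightarrow> expvec \<times> expvec" where
  "homog = (\<lambda>(u, v). (u, v + Poly_Mapping.single n (weight n w u - weight n w v)))"

text \<open>Rewriting never raises the weight, so each step lifts to the weighted semigroup by
  moving the lost weight into the exponent of \<open>t\<close>, which never has to become
  negative.\<close>

lemma homog_presentation:
  assumes a: "a ` {..<n} \<subseteq> int_vecs d"
  shows "is_presentation (Suc n) (weighted_gens d n a w) (homog ` pairs)"
proof (rule is_presentationI)
  let ?b = "weighted_gens d n a w" and ?T = "Poly_Mapping.single n :: nat \<Rightarrow> expvec"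
  show sub: "homog ` pairs \<subseteq> kernel_congruence (Suc n) ?b"
  proof clarify
    fix \<alpha> \<beta> u v assume h: "(\<alpha>, \<beta>) = homog (u, v)" and uv: "(u, v) \<in> pairs"
    have ker: "u \<in> exp_vecs n" "v \<in> exp_vecs n" "factor_map n a u = factor_map n a v"
      using pairs_kernel uv by (auto simp: kernel_congruence_def)
    have "weight n w v \<le> weight n w u"
      using uv by (auto simp: pairs_def intro: lt_weight)
    \<comment> \<open>The leading side is written with an explicit zero power of \<open>t\<close> to
      fit the equivalence, so \<open>single_zero\<close> must not erase it.\<close>
    then have "factor_map (Suc n) ?b (u + ?T 0) = factor_map (Suc n) ?b \<beta>"
      using h ker factor_map_weighted_eq_iff[OF a] by (simp add: homog_def del: single_zero)
    then show "(\<alpha>, \<beta>) \<in> kernel_congruence (Suc n) ?b"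
      using h ker exp_vecs_mono[of n "Suc n"] by (simp add: kernel_congruence_def homog_def)
  qed
  let ?H = "is_congruence (Suc n) hull (homog ` pairs)"
  have "is_congruence (Suc n) ?H"
    using sub kernel_congruence_subset by (blast intro: is_congruence_hull)
  note H = is_congruenceD[OF this]
  \<comment> \<open>The exponents of \<open>t\<close> are quantified inside the induction because a
    rewriting step changes them.\<close>
  have main: "\<forall>s t. weight n w x + s = weight n w y + t \<longrightarrow> (x + ?T s, y + ?T t) \<in> ?H"
    if "(x, y) \<in> kernel_congruence n a" for x y
    using that
  proof (induction rule: kernel_induct)
    case (refl x)
    then show ?case using exp_vecs_mono[of n "Suc n" x] by (auto intro: H(2))
  next
    case (sym x y)
    then show ?case using H(3) by metis
  next
    case (step u v c y)
    show ?case
    proof (intro allI impI)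
      fix s t assume st: "weight n w (u + c) + s = weight n w y + t"
      let ?e = "weight n w u - weight n w v"
      have le: "weight n w v \<le> weight n w u"
        using step(1) by (auto simp: pairs_def intro: lt_weight)
      have "(u, v + ?T ?e) \<in> ?H"
        using step(1) by (intro hull_inc) (auto simp: homog_def intro: rev_image_eqI)
      moreover have "c + ?T s \<in> exp_vecs (Suc n)"
        using step(2) exp_vecs_mono[of n "Suc n" c] by simp
      ultimately have "(u + (c + ?T s), v + ?T ?e + (c + ?T s)) \<in> ?H"
        by (rule H(5))
      moreover have "v + ?T ?e + (c + ?T s) = v + c + ?T (?e + s)"
        by (simp add: single_add ac_simps)
      ultimately have "(u + c + ?T s, v + c + ?T (?e + s)) \<in> ?H"
        by (simp add: add.assoc)
      \<comment> \<open>The induction hypothesis is used at \<open>?e + s\<close>, which compensates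
        exactly for the drop in weight from \<open>u\<close> to \<open>v\<close>.\<close>
      moreover have "(v + c + ?T (?e + s), y + ?T t) \<in> ?H"
        using step(3) st le by (simp add: weight_add)
      ultimately show "(u + c + ?T s, y + ?T t) \<in> ?H"
        by (rule H(4))
    qed
  qed
  fix z z' assume ker: "(z, z') \<in> kernel_congruence (Suc n) ?b"
  then have E: "z \<in> exp_vecs (Suc n)" "z' \<in> exp_vecs (Suc n)"
    by (auto simp: kernel_congruence_def)
  obtain x s where x: "x \<in> exp_vecs n" "z = x + ?T s"
    using E(1) by (rule exp_vecs_Suc_decomp)
  obtain y t where y: "y \<in> exp_vecs n" "z' = y + ?T t"
    using E(2) by (rule exp_vecs_Suc_decomp)
  have "factor_map n a x = factor_map n a y" "weight n w x + s = weight n w y + t"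
    using ker factor_map_weighted_eq_iff[OF a x(1) y(1)] x(2) y(2)
    by (auto simp: kernel_congruence_def)
  then show "(z, z') \<in> ?H" using main x y by (simp add: kernel_congruence_def)
qed

text \<open>Each condition is pulled back to \<open>pairs\<close>, where it follows from unique
  presentability of \<open>S\<close> or from asymmetry of the order.\<close>

lemma homog_uniform_presentation:
  assumes a: "a ` {..<n} \<subseteq> int_vecs d" and uniq: "uniquely_presented n a"
  shows "uniform_presentation (Suc n) (weighted_gens d n a w) (homog ` pairs)"
  unfolding uniform_presentation_def
proof (intro conjI homog_presentation[OF a] allI impI)
  let ?b = "weighted_gens d n a w" and ?T = "Poly_Mapping.single n :: nat \<Rightarrow> expvec"
  fix \<alpha> \<beta> assume "(\<alpha>, \<beta>) \<in> homog ` pairs"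
  then obtain u v where uv: "(u, v) \<in> pairs" "\<alpha> = u"
    "\<beta> = v + ?T (weight n w u - weight n w v)"
    by (auto simp: homog_def)
  have lt: "lt v u" using uv(1) by (simp add: pairs_def)
  note le = lt_weight[OF lt] and E = lt_exp_vecs[OF lt]
  show "(\<beta>, \<alpha>) \<notin> homog ` pairs"
  proof
    assume "(\<beta>, \<alpha>) \<in> homog ` pairs"
    then obtain u' v' where uv': "(u', v') \<in> pairs" "\<beta> = u'"
      "\<alpha> = v' + ?T (weight n w u' - weight n w v')"
      by (auto simp: homog_def)
    have lt': "lt v' u'" using uv'(1) by (simp add: pairs_def)
    note E' = lt_exp_vecs[OF lt']
    \<comment> \<open>Neither \<open>u\<close> nor \<open>u'\<close> involves \<open>t\<close>.
      Comparing parts free of \<open>t\<close> gives \<open>v = u'\<close> and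
      \<open>v' = u\<close>, so the two pairs would be oriented in opposite ways.\<close>
    have "v + ?T (weight n w u - weight n w v) = u' + ?T 0"
      using uv(3) uv'(2) by simp
    then have "v = u'" using add_single_eq_iff E E' by blast
    moreover have "v' + ?T (weight n w u' - weight n w v') = u + ?T 0"
      using uv(2) uv'(3) by simp
    then have "v' = u" using add_single_eq_iff E E' by blast
    ultimately show False using lt lt' lt_asym by blast
  qed
  show "\<forall>\<gamma>\<in>exp_vecs (Suc n). factor_map (Suc n) ?b \<gamma> = factor_map (Suc n) ?b \<alpha> \<longrightarrow>
    \<gamma> = \<alpha> \<or> \<gamma> = \<beta>"
  proof (intro ballI impI)
    fix \<gamma> assume "\<gamma> \<in> exp_vecs (Suc n)" and eq: "factor_map (Suc n) ?b \<gamma> = factor_map (Suc n) ?b \<alpha>"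
    then obtain x s where x: "x \<in> exp_vecs n" "\<gamma> = x + ?T s"
      using exp_vecs_Suc_decomp by blast
    have "factor_map (Suc n) ?b (x + ?T s) = factor_map (Suc n) ?b (u + ?T 0)"
      using eq x(2) uv(2) by simp
    then have xu: "factor_map n a x = factor_map n a u" "weight n w x + s = weight n w u + 0"
      using factor_map_weighted_eq_iff[OF a x(1) E(2)] by blast+
    \<comment> \<open>The two-element fiber of \<open>S\<close> leaves two choices for
      \<open>x\<close>, and the weight equation then fixes \<open>s\<close>: zero for
      \<open>u\<close>, the weight difference for \<open>v\<close>.\<close>
    then consider "x = u" | "x = v"
      using unique_presentation_fiber[OF uniq pairs_minimal finite_pairs uv(1) x(1)] by blast
    then show "\<gamma> = \<alpha> \<or> \<gamma> = \<beta>"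
    proof cases
      case 1
      then show ?thesis using xu(2) x(2) uv(2) by simp
    next
      case 2
      then have "s = weight n w u - weight n w v" using xu(2) by simp
      then show ?thesis using x(2) uv(3) 2 by simp
    qed
  qed
  fix \<alpha>' \<beta>' c assume c: "\<alpha> = \<alpha>' + c" "\<beta> = \<beta>' + c"
  \<comment> \<open>As a summand of \<open>u\<close>, the vector \<open>c\<close> is free of
    \<open>t\<close>, so it is already a summand of \<open>v\<close>, and disjointness in
    \<open>S\<close> applies.\<close>
  have ce: "c \<in> exp_vecs n" using c(1) uv(2) E(2) by simp
  have "\<beta> \<in> exp_vecs (Suc n)"
    using uv(3) E(1) exp_vecs_mono[of n "Suc n" v] by simp
  then have "\<beta>' \<in> exp_vecs (Suc n)" using c(2) by simp
  then obtain x s where x: "x \<in> exp_vecs n" "\<beta>' = x + ?T s"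
    using exp_vecs_Suc_decomp by blast
  have "v + ?T (weight n w u - weight n w v) = (x + c) + ?T s"
    using c(2) x(2) uv(3) by (simp add: ac_simps)
  then have "v = x + c" using add_single_eq_iff[of v n "x + c"] E x(1) ce by simp
  then have "(\<alpha>' + c, x + c) \<in> pairs" using uv c(1) by simp
  then show "c = 0"
    by (rule unique_presentation_disjoint[OF uniq pairs_minimal finite_pairs])
qed

end

theorem corollary4p12:
  fixes d n :: nat
    and S :: "intvec set"
    and a :: "nat \<Rightarrow> intvec"
    and w :: "nat \<Rightarrow> nat"
  assumes "affine_semigroup d S"
    and "pointed S"
    and "S = semigroup_of n a"
    and "uniquely_presented n a"
    and "\<exists>(G :: 'k::field mpol set) r.
           minimal_generating_set n (toric_ideal n a) G \<and>
           monomial_order n r \<and>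
           groebner_basis n (refined_order n w r) (toric_ideal n a) G"
  shows "(\<forall>b \<in> Betti (n + 1) (weighted_gens d n a w).
            Betti_minimal (n + 1) (weighted_gens d n a w) b) \<and>
         uniquely_presented (n + 1) (weighted_gens d n a w)"
proof -
  obtain G :: "'k mpol set" and r where "ordered_binomials n a w G r"
    using assms(5) by (auto simp: ordered_binomials_def)
  then interpret ordered_binomials n a w G r .
  \<comment> \<open>The generators lie in \<open>int_vecs d\<close>, which makes coordinate
    \<open>d\<close> free to record the weight.\<close>
  have "a ` {..<n} \<subseteq> S"
    unfolding assms(3) semigroup_of_def by (rule hull_subset)
  also have "S \<subseteq> int_vecs d"
    using assms(1) by (simp add: affine_semigroup_def)
  finally have "a ` {..<n} \<subseteq> int_vecs d" .
  then have "uniform_presentation (Suc n) (weighted_gens d n a w) (homog ` pairs)"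
    by (intro homog_uniform_presentation assms(4))
  then show ?thesis
    using uniform_presentation_Betti_minimal uniform_presentation_uniquely_presented
    by simp
qed

end
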